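(* Fix $n\ge 1$. Consider formulae generated by the grammar $$\phi \;::=\; y_i \mid \hat y_i \mid r \mid \neg\phi \mid \phi\wedge\phi \mid \phi\vee\phi \mid \phi\multimap\phi,$$ where $1\le i\le n$ and $r$ ranges over $[-\infty,+\infty]$. For a point $z=(z_1,\dots,z_{2n})\in\mathbb{R}^{2n}$, define the quantitative semantics $[\![\phi]\!]_\infty(z)\in[-\infty,+\infty]$ inductively by $[\![\hat y_i]\!]_\infty(z)=z_i$, $[\![y_i]\!]_\infty(z)=z_{n+i}$, $[\![r]\!]_\infty(z)=r$, $[\![\neg\phi]\!]_\infty=-[\![\phi]\!]_\infty$, $[\![\phi\wedge\psi]\!]_\infty=\max([\![\phi]\!]_\infty,[\![\psi]\!]_\infty)$, $[\![\phi\vee\psi]\!]_\infty=\min([\![\phi]\!]_\infty,[\![\psi]\!]_\infty)$, and $[\![\phi\multimap\psi]\!]_\infty=[\![\psi]\!]_\infty-[\![\phi]\!]_\infty$ (all pointwise in $z$). Define the Boolean semantics $[\![\phi]\!]_{\mathbb{B}}(z)\in\{\mathbf{true},\mathbf{false}\}$ inductively by $[\![\hat y_i]\!]_{\mathbb{B}}(z)=(z_i\le 0)$, $[\![y_i]\!]_{\mathbb{B}}(z)=(z_{n+i}\le 0)$, $[\![r]\!]_{\mathbb{B}}=(r\le 0)$, $[\![\neg\phi]\!]_{\mathbb{B}}=([\![\phi]\!]_\infty\ge 0)$, $[\![\phi\wedge\psi]\!]_{\mathbb{B}}=[\![\phi]\!]_{\mathbb{B}}\land[\![\psi]\!]_{\mathbb{B}}$,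 $[\![\phi\vee\psi]\!]_{\mathbb{B}}=[\![\phi]\!]_{\mathbb{B}}\lor[\![\psi]\!]_{\mathbb{B}}$, and $[\![\phi\multimap\psi]\!]_{\mathbb{B}}=([\![\psi]\!]_\infty\le[\![\phi]\!]_\infty)$ (all pointwise in $z$). Then for every such formula $\phi$ and every $z\in\mathbb{R}^{2n}$, $$[\![\phi]\!]_{\mathbb{B}}(z)=\mathbf{true}\iff [\![\phi]\!]_\infty(z)\le 0.$$
   Context: Truth values live in the extended reals $[-\infty,+\infty]$, with the convention that lower values are "more true". Negation is $-(\pm\infty)=\mp\infty$. The difference $b-a$ used for implication is defined as $(-a)+^*b$, where $+^*$ is ordinary addition on finite values extended by the convention $-\infty+^*\infty=+\infty+^*(-\infty)=-\infty$ (so in particular $+\infty-(+\infty)=-\infty$ and $-\infty-(-\infty)=-\infty$). The symbols $\hat y_i$ stand for the entries of a data label and $y_i$ for the model outputs, which is why they are interpreted as the coordinates $z_i$ and $z_{n+i}$ respectively. *)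

theory Defs
  imports "HOL-Library.Extended_Real" "HOL-Library.FuncSet"
begin

text \<open>Addition on the extended reals that resolves the indeterminate case to \<open>-\<infinity>\<close>;
  the library's \<open>+\<close> on \<^typ>\<open>ereal\<close> resolves it to \<open>\<infinity>\<close>.\<close>

definition plus_star :: "ereal \<Rightarrow> ereal \<Rightarrow> ereal" (infixl "+\<^sup>*" 65) where
  "a +\<^sup>* b = (if (a = -\<infinity> \<and> b = \<infinity>) \<or> (a = \<infinity> \<and> b = -\<infinity>) then -\<infinity> else a + b)"

definition minus_star :: "ereal \<Rightarrow> ereal \<Rightarrow> ereal" (infixl "-\<^sup>*" 65) where
  "b -\<^sup>* a = (- a) +\<^sup>* b"

lemma minus_star_infinite [simp]:
  "\<infinity> -\<^sup>* \<infinity> = -\<infinity>" "(-\<infinity>) -\<^sup>* (-\<infinity>) = -\<infinity>"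
  by (simp_all add: minus_star_def plus_star_def)

text \<open>\<open>Out i\<close> is \<open>y\<^sub>i\<close> (model output) and \<open>Lab i\<close> is \<open>y\<^sub>i\<close> with a hat (data label).
  The datatype leaves the indices unrestricted; \<open>formulae n\<close> is the language with
  indices \<open>1, \<dots>, n\<close>.\<close>

datatype formula =
    Out nat
  | Lab nat
  | Const ereal
  | Neg formula
  | And formula formula
  | Or formula formula
  | Impl formula formula

inductive_set formulae :: "nat \<Rightarrow> formula set" for n :: nat where
  "1 \<le> i \<Longrightarrow> i \<le> n \<Longrightarrow> Out i \<in> formulae n"
| "1 \<le> i \<Longrightarrow> i \<le> n \<Longrightarrow> Lab i \<in> formulae n"
| "Const r \<in> formulae n"
| "\<phi> \<in> formulae n \<Longrightarrow> Neg \<phi> \<in> formulae n"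
| "\<phi> \<in> formulae n \<Longrightarrow> \<psi> \<in> formulae n \<Longrightarrow> And \<phi> \<psi> \<in> formulae n"
| "\<phi> \<in> formulae n \<Longrightarrow> \<psi> \<in> formulae n \<Longrightarrow> Or \<phi> \<psi> \<in> formulae n"
| "\<phi> \<in> formulae n \<Longrightarrow> \<psi> \<in> formulae n \<Longrightarrow> Impl \<phi> \<psi> \<in> formulae n"

text \<open>A point of \<open>\<real>\<^sup>2\<^sup>n\<close> is a function with coordinates \<open>z 1, \<dots>, z (2 * n)\<close>,
  extensional on \<open>{1..2 * n}\<close>.\<close>

definition points :: "nat \<Rightarrow> (nat \<Rightarrow> real) set" where
  "points n = {1..2 * n} \<rightarrow>\<^sub>E UNIV"

text \<open>Lower values are more true, so conjunction is \<open>max\<close> and disjunction is \<open>min\<close>.\<close>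

primrec sem_inf :: "nat \<Rightarrow> formula \<Rightarrow> (nat \<Rightarrow> real) \<Rightarrow> ereal" where
  "sem_inf n (Out i) z = ereal (z (n + i))"
| "sem_inf n (Lab i) z = ereal (z i)"
| "sem_inf n (Const r) z = r"
| "sem_inf n (Neg \<phi>) z = - sem_inf n \<phi> z"
| "sem_inf n (And \<phi> \<psi>) z = max (sem_inf n \<phi> z) (sem_inf n \<psi> z)"
| "sem_inf n (Or \<phi> \<psi>) z = min (sem_inf n \<phi> z) (sem_inf n \<psi> z)"
| "sem_inf n (Impl \<phi> \<psi>) z = sem_inf n \<psi> z -\<^sup>* sem_inf n \<phi> z"

primrec sem_bool :: "nat \<Rightarrow> formula \<Rightarrow> (nat \<Rightarrow> real) \<Rightarrow> bool" where
  "sem_bool n (Out i) z \<longleftrightarrow> z (n + i) \<le> 0"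
| "sem_bool n (Lab i) z \<longleftrightarrow> z i \<le> 0"
| "sem_bool n (Const r) z \<longleftrightarrow> r \<le> 0"
| "sem_bool n (Neg \<phi>) z \<longleftrightarrow> sem_inf n \<phi> z \<ge> 0"
| "sem_bool n (And \<phi> \<psi>) z \<longleftrightarrow> sem_bool n \<phi> z \<and> sem_bool n \<psi> z"
| "sem_bool n (Or \<phi> \<psi>) z \<longleftrightarrow> sem_bool n \<phi> z \<or> sem_bool n \<psi> z"
| "sem_bool n (Impl \<phi> \<psi>) z \<longleftrightarrow> sem_inf n \<psi> z \<le> sem_inf n \<phi> z"

end

theory Submission
  imports Defs
begin

text \<open>Structural induction: being \<open>\<le> 0\<close> turns \<open>max\<close> into
  conjunction and \<open>min\<close> into disjunction, and \<open>Neg\<close>, \<open>Impl\<close>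
  already have Boolean clauses comparing quantitative values. Only \<open>Impl\<close> is delicate:
  for equal infinite values the comparison holds, so their difference must be
  \<open>\<le> 0\<close>, which the value \<open>-\<infinity>\<close> ensures.\<close>

lemma minus_star_le_0_iff: "b -\<^sup>* a \<le> 0 \<longleftrightarrow> b \<le> a"
  by (cases a; cases b) (auto simp: minus_star_def plus_star_def)

theorem mainTheorem2:
  fixes n :: nat and \<phi> :: formula and z :: "nat \<Rightarrow> real"
  assumes "n \<ge> 1"
    and "\<phi> \<in> formulae n"
    and "z \<in> points n"
  shows "sem_bool n \<phi> z \<longleftrightarrow> sem_inf n \<phi> z \<le> 0"
  \<comment> \<open>\<open>minus_star_le_0_iff\<close> settles \<open>Impl\<close>,
    \<open>min_le_iff_disj\<close> settles \<open>Or\<close>.\<close>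
  by (induction \<phi>) (auto simp: minus_star_le_0_iff min_le_iff_disj)

end
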